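(* For every fixed integer $k\ge 1$, the probability $P_{n,k}=\frac{B_{n,k}}{C_n}$ that a Dyck path of order $n$ reaches the line $y=x+k$ approaches $1$ as $n$ approaches infinity, i.e. $$\lim_{n\to\infty}P_{n,k}=\lim_{n\to\infty}\frac{B_{n,k}}{C_n}=1.$$
   Context: A Dyck path of order $n\ge 1$ is a lattice path in the plane from $(0,0)$ to $(n,n)$ consisting of $2n$ unit steps, each going either up (adding $(0,1)$) or to the right (adding $(1,0)$), that never goes below the diagonal $y=x$ (touching the diagonal is allowed). The number of Dyck paths of order $n$ is the Catalan number $C_n=\frac{1}{n+1}\binom{2n}{n}$. $B_{n,k}$ denotes the number of Dyck paths of order $n$ which hit or cross the line $y=x+k$, i.e. which visit at least one lattice point $(x,y)$ with $y-x\ge k$. Equivalently, $B_{n,k}$ is the number of sequences $a_1,\dots,a_{2n}$ of nonnegative integers with $a_1=1$, $a_{2n}=0$, $|a_i-a_{i+1}|=1$ for $1\le i<2n$, in which the value $k$ occurs at least once. The probability $P_{n,k}$ is with respect to the uniform distribution on the $C_n$ Dyck paths of order $n$, so $P_{n,k}=B_{n,k}/C_n$. *)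

theory Defs
  imports "HOL-Probability.Probability"
begin

datatype step = Up | Right

fun displacement :: "step \<Rightarrow> int \<times> int" where
  "displacement Up = (0, 1)"
| "displacement Right = (1, 0)"

text \<open>The lattice point reached from the origin by following all steps of a path.\<close>

definition endpoint :: "step list \<Rightarrow> int \<times> int" where
  "endpoint p = sum_list (map displacement p)"

definition visited :: "step list \<Rightarrow> (int \<times> int) set" where
  "visited p = {endpoint (take i p) | i. i \<le> length p}"

definition dyck_paths :: "nat \<Rightarrow> step list set" where
  "dyck_paths n = {p. length p = 2 * n \<and> endpoint p = (int n, int n) \<and>
     (\<forall>(x, y) \<in> visited p. x \<le> y)}"

text \<open>A path hits or crosses the line \<open>y = x + k\<close> if it visits a lattice point on or above it.\<close>

definition reaches_line :: "int \<Rightarrow> step list \<Rightarrow> bool" where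
  "reaches_line k p \<longleftrightarrow> (\<exists>(x, y) \<in> visited p. y - x \<ge> k)"

definition B :: "nat \<Rightarrow> int \<Rightarrow> nat" where
  "B n k = card {p \<in> dyck_paths n. reaches_line k p}"

definition catalan :: "nat \<Rightarrow> real" where
  "catalan n = 1 / (real n + 1) * real ((2 * n) choose n)"

text \<open>The uniform distribution \<^const>\<open>pmf_of_set\<close> is meaningful only on finite nonempty sets.\<close>

lemma finite_dyck_paths: "finite (dyck_paths n)"
proof -
  have "(UNIV :: step set) = {Up, Right}"
    using step.exhaust by auto
  then have "finite (UNIV :: step set)"
    by (metis finite.emptyI finite.insertI)
  then have "finite {p :: step list. set p \<subseteq> UNIV \<and> length p = 2 * n}"
    by (rule finite_lists_length_eq)
  then show ?thesis
    by (rule finite_subset[rotated]) (auto simp: dyck_paths_def)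
qed

lemma dyck_paths_nonempty: "dyck_paths n \<noteq> {}"
proof -
  have up: "endpoint (replicate m Up) = (0, int m)" for m
    by (induction m) (auto simp: endpoint_def zero_prod_def)
  have right: "endpoint (replicate m Right) = (int m, 0)" for m
    by (induction m) (auto simp: endpoint_def zero_prod_def)
  have "endpoint (xs @ ys) = endpoint xs + endpoint ys" for xs ys
    by (simp add: endpoint_def)
  then have "replicate n Up @ replicate n Right \<in> dyck_paths n"
    by (auto simp: dyck_paths_def visited_def up right min_def split: if_splits)
  then show ?thesis
    by blast
qed

definition P :: "nat \<Rightarrow> int \<Rightarrow> real" where
  "P n k = measure_pmf.prob (pmf_of_set (dyck_paths n)) {p. reaches_line k p}"

end

theory Submission
  imports Defs "HOL-Real_Asymp.Real_Asymp"
begin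

text \<open>
  A Dyck path that misses the line \<open>y = x + k\<close> is confined to the strip
  \<open>0 \<le> y - x < k\<close>, and confinement to a strip of fixed width costs an exponential
  factor: no \<open>k\<close> consecutive steps can all go up, so among the \<open>2 ^ k\<close> possible
  patterns for each block of \<open>k\<close> steps at least one is excluded. Hence at most
  \<open>4 ^ n * c ^ (2 * n div k)\<close> Dyck paths of order \<open>n\<close> miss the line, where
  \<open>c = 1 - 1 / 2 ^ k < 1\<close> (\<open>card_strip_paths_le\<close>). The Catalan number, on the other
  hand, falls short of \<open>4 ^ n\<close> by a polynomial factor only (\<open>catalan_lower_bound\<close>).
  The fraction of paths that miss the line therefore tends to \<open>0\<close>.

  That the formula for the Catalan number counts Dyck paths is \<open>card_dyck_paths\<close>. It
  comes from the ballot numbers, which count the paths to an arbitrary point \<open>(d, u)\<close>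
  that stay weakly above the diagonal: removing the last step gives these numbers the recursion
  of Pascal's triangle.
\<close>

section \<open>Lattice points of a path\<close>

lemma endpoint_append: "endpoint (p @ q) = endpoint p + endpoint q"
  by (simp add: endpoint_def)

lemma endpoint_Nil: "endpoint [] = (0, 0)"
  by (simp add: endpoint_def zero_prod_def)

lemma endpoint_singleton: "endpoint [s] = displacement s"
  by (simp add: endpoint_def)

lemma visited_append: "visited p \<subseteq> visited (p @ q)"
proof
  fix z assume "z \<in> visited p"
  then obtain i where "i \<le> length p" "z = endpoint (take i p)"
    by (auto simp: visited_def)
  then have "z = endpoint (take i (p @ q))" "i \<le> length (p @ q)"
    by auto
  then show "z \<in> visited (p @ q)"
    by (auto simp: visited_def)
qed

lemma endpoint_in_visited: "endpoint p \<in> visited p"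
  unfolding visited_def by (rule CollectI, rule exI[of _ "length p"]) simp

lemma visited_Nil: "visited [] = {(0, 0)}"
  by (simp add: visited_def endpoint_Nil)

lemma visited_snoc: "visited (p @ [s]) = insert (endpoint (p @ [s])) (visited p)"
proof
  show "visited (p @ [s]) \<subseteq> insert (endpoint (p @ [s])) (visited p)"
    by (auto simp: visited_def le_Suc_eq)
  show "insert (endpoint (p @ [s])) (visited p) \<subseteq> visited (p @ [s])"
    using visited_append endpoint_in_visited by auto
qed

lemma endpoint_sum_eq_length: "fst (endpoint p) + snd (endpoint p) = int (length p)"
proof (induction p rule: rev_induct)
  case Nil
  then show ?case by (simp add: endpoint_Nil)
next
  case (snoc s p)
  then show ?case by (cases s) (auto simp: endpoint_append endpoint_singleton)
qed

lemma endpoint_nonneg: "0 \<le> fst (endpoint p)" "0 \<le> snd (endpoint p)"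
proof (induction p rule: rev_induct)
  case Nil
  case 1 show ?case by (simp add: endpoint_Nil)
  case 2 show ?case by (simp add: endpoint_Nil)
next
  case (snoc s p)
  case 1 from snoc show ?case by (cases s) (auto simp: endpoint_append endpoint_singleton)
  case 2 from snoc show ?case by (cases s) (auto simp: endpoint_append endpoint_singleton)
qed

lemma endpoint_replicate_Up: "endpoint (replicate m Up) = (0, int m)"
  by (induction m) (auto simp: endpoint_def zero_prod_def)

section \<open>Counting Dyck paths\<close>

text \<open>
  Endpoints off the diagonal are allowed so that removing the last step of a path leads to another
  set of the same family. The length of a path is fixed by its endpoint.
\<close>

definition ballot_paths :: "nat \<Rightarrow> nat \<Rightarrow> step list set" where
  "ballot_paths u d = {p. endpoint p = (int d, int u) \<and> (\<forall>(x, y) \<in> visited p. x \<le> y)}"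

lemma dyck_paths_eq_ballot_paths: "dyck_paths n = ballot_paths n n"
proof -
  have "length p = 2 * n" if "endpoint p = (int n, int n)" for p
    using endpoint_sum_eq_length[of p] that by simp
  then show ?thesis
    by (auto simp: dyck_paths_def ballot_paths_def)
qed

lemma ballot_paths_below_diagonal: "u < d \<Longrightarrow> ballot_paths u d = {}"
  using endpoint_in_visited by (fastforce simp: ballot_paths_def)

lemma ballot_paths_no_right: "ballot_paths u 0 = {replicate u Up}"
proof (induction u)
  case 0
  have "p = []" if "endpoint p = (0, 0)" for p
    using endpoint_sum_eq_length[of p] that by simp
  then show ?case
    by (auto simp: ballot_paths_def endpoint_Nil visited_Nil)
next
  case (Suc u)
  have "p \<in> ballot_paths (Suc u) 0 \<longleftrightarrow> p \<in> (\<lambda>p. p @ [Up]) ` ballot_paths u 0" for p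
  proof (cases p rule: rev_cases)
    case Nil
    then show ?thesis by (auto simp: ballot_paths_def endpoint_Nil)
  next
    case (snoc q s)
    then show ?thesis
      using endpoint_nonneg(1)[of q]
      by (cases s; cases "endpoint q")
        (auto simp: ballot_paths_def endpoint_append endpoint_singleton visited_snoc)
  qed
  then have "ballot_paths (Suc u) 0 = (\<lambda>p. p @ [Up]) ` ballot_paths u 0"
    by blast
  then show ?case
    using Suc by (simp add: replicate_append_same)
qed

lemma ballot_paths_rec:
  assumes "d \<le> u"
  shows "ballot_paths (Suc u) (Suc d) =
    (\<lambda>p. p @ [Up]) ` ballot_paths u (Suc d) \<union> (\<lambda>p. p @ [Right]) ` ballot_paths (Suc u) d"
    (is "?L = ?R")
proof -
  have "p \<in> ?L \<longleftrightarrow> p \<in> ?R" for p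
  proof (cases p rule: rev_cases)
    case Nil
    then show ?thesis by (auto simp: ballot_paths_def endpoint_Nil)
  next
    case (snoc q s)
    then show ?thesis using assms
      by (cases s; cases "endpoint q")
        (auto simp: ballot_paths_def endpoint_append endpoint_singleton visited_snoc)
  qed
  then show ?thesis by blast
qed

lemma finite_ballot_paths: "finite (ballot_paths u d)"
proof -
  have "finite (UNIV :: step set)"
    by (rule finite_subset[of _ "{Up, Right}"]) (auto intro: step.exhaust)
  then have "finite {p :: step list. set p \<subseteq> UNIV \<and> length p = u + d}"
    by (rule finite_lists_length_eq)
  moreover have "length p = u + d" if "p \<in> ballot_paths u d" for p
    using endpoint_sum_eq_length[of p] that by (simp add: ballot_paths_def)
  ultimately show ?thesis
    by (rule_tac finite_subset[rotated]) auto
qed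

text \<open>
  Both \<open>(u + d) choose u\<close> and \<open>(u + d) choose Suc u\<close> satisfy Pascal's rule, which
  is also the recursion for the paths by their last step, so only the boundary has to be checked.
  On the line \<open>d = Suc u\<close>, just below the diagonal, there are no paths, and the two binomial
  coefficients agree by symmetry; including this line in the range of \<open>d\<close> gives the
  recursion a boundary value to start from. (By the reflection principle, the second coefficient
  counts the paths that go below the diagonal.)
\<close>

lemma card_ballot_paths:
  "d \<le> Suc u \<Longrightarrow> card (ballot_paths u d) + ((u + d) choose Suc u) = (u + d) choose u"
proof (induction "u + d" arbitrary: u d)
  case 0
  then show ?case by (simp add: ballot_paths_no_right)
next
  case (Suc m)
  consider "d = 0" | "d = Suc u" | u' d' where "u = Suc u'" "d = Suc d'" "d' \<le> u'"
    using Suc.prems by (cases d; cases u) (auto simp: le_Suc_eq)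
  then show ?case
  proof cases
    case 1
    then show ?thesis by (simp add: ballot_paths_no_right)
  next
    case 2
    then show ?thesis
      using binomial_symmetric[of u "u + Suc u"] by (simp add: ballot_paths_below_diagonal)
  next
    case 3
    have "card (ballot_paths u d) = card ((\<lambda>p. p @ [Up]) ` ballot_paths u' d)
        + card ((\<lambda>p. p @ [Right]) ` ballot_paths u d')"
      unfolding 3(1,2) ballot_paths_rec[OF 3(3)]
      by (rule card_Un_disjoint) (auto intro: finite_ballot_paths)
    also have "\<dots> = card (ballot_paths u' d) + card (ballot_paths u d')"
      by (simp add: card_image inj_on_def)
    finally have "card (ballot_paths u d) = card (ballot_paths u' d) + card (ballot_paths u d')" .
    moreover have "card (ballot_paths u' d) + ((u' + d) choose Suc u') = (u' + d) choose u'"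
      using Suc.hyps(1)[of u' d] Suc.hyps(2) 3 by simp
    moreover have "card (ballot_paths u d') + ((u + d') choose Suc u) = (u + d') choose u"
      using Suc.hyps(1)[of u d'] Suc.hyps(2) 3 by simp
    ultimately show ?thesis
      using 3 by simp
  qed
qed

lemma card_dyck_paths: "real (card (dyck_paths n)) = catalan n"
proof -
  have "card (dyck_paths n) + ((2 * n) choose Suc n) = (2 * n) choose n"
    using card_ballot_paths[of n n] by (simp add: dyck_paths_eq_ballot_paths mult_2)
  then have 1: "real (card (dyck_paths n)) + real ((2 * n) choose Suc n) = real ((2 * n) choose n)"
    by (metis of_nat_add)
  have "Suc n * ((2 * n) choose Suc n) = n * ((2 * n) choose n)"
    using binomial_absorb_comp[of "2 * n" n] binomial_absorption[of n "2 * n"]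
    by (metis add_diff_cancel_left' mult_2)
  then have "(real n + 1) * real ((2 * n) choose Suc n) = real n * real ((2 * n) choose n)"
    by (metis of_nat_Suc of_nat_mult add.commute)
  moreover have "(real n + 1) * real (card (dyck_paths n))
      = (real n + 1) * real ((2 * n) choose n) - (real n + 1) * real ((2 * n) choose Suc n)"
    unfolding 1[symmetric] by (simp only: distrib_left add_diff_cancel_right')
  ultimately have "(real n + 1) * real (card (dyck_paths n)) = real ((2 * n) choose n)"
    by (simp add: distrib_right)
  then show ?thesis
    by (simp add: catalan_def field_simps)
qed

section \<open>Paths confined to a strip\<close>

definition strip_paths :: "nat \<Rightarrow> nat \<Rightarrow> step list set" where
  "strip_paths k m = {p. length p = m \<and> (\<forall>(x, y) \<in> visited p. x \<le> y \<and> y - x < int k)}"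

lemma card_step_lists: 
  "finite {p :: step list. length p = m}" "card {p :: step list. length p = m} = 2 ^ m"
proof -
  have U: "(UNIV :: step set) = {Up, Right}"
    using step.exhaust by auto
  have "card (UNIV :: step set) = 2"
    by (simp add: U)
  moreover have "finite (UNIV :: step set)"
    by (simp add: U)
  ultimately show "finite {p :: step list. length p = m}" "card {p :: step list. length p = m} = 2 ^ m"
    using finite_lists_length_eq[of "UNIV :: step set" m] card_lists_length_eq[of "UNIV :: step set" m]
    by simp_all
qed

lemma finite_strip_paths: "finite (strip_paths k m)"
  by (rule finite_subset[OF _ card_step_lists(1)[of m]]) (auto simp: strip_paths_def)

text \<open>
  Cut the path \<open>k\<close> steps before its end. The first part stays in the strip, and the
  second cannot consist of up-steps only, as it would climb by the full width of the strip.
\<close>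

lemma card_strip_paths_add:
  "card (strip_paths k (m + k)) \<le> card (strip_paths k m) * (2 ^ k - 1)"
proof -
  let ?Q = "{q. length q = k} - {replicate k Up}"
  have "(\<lambda>p. (take m p, drop m p)) ` strip_paths k (m + k) \<subseteq> strip_paths k m \<times> ?Q"
  proof (rule image_subsetI)
    fix p assume p: "p \<in> strip_paths k (m + k)"
    have "visited (take m p) \<subseteq> visited p"
      using visited_append[of "take m p" "drop m p"] by simp
    with p have pre: "take m p \<in> strip_paths k m"
      by (auto simp: strip_paths_def)
    have "drop m p \<noteq> replicate k Up"
    proof
      assume "drop m p = replicate k Up"
      then have "endpoint p = endpoint (take m p) + (0, int k)"
        using endpoint_append[of "take m p" "drop m p"]
        unfolding append_take_drop_id by (simp add: endpoint_replicate_Up)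
      moreover have "fst (endpoint (take m p)) \<le> snd (endpoint (take m p))"
        using pre endpoint_in_visited[of "take m p"] by (auto simp: strip_paths_def)
      moreover have "snd (endpoint p) - fst (endpoint p) < int k"
        using p endpoint_in_visited[of p] by (auto simp: strip_paths_def)
      ultimately show False
        by simp
    qed
    with pre p show "(take m p, drop m p) \<in> strip_paths k m \<times> ?Q"
      by (auto simp: strip_paths_def)
  qed
  moreover have "inj_on (\<lambda>p. (take m p, drop m p)) (strip_paths k (m + k))"
    by (rule inj_onI) (metis append_take_drop_id prod.inject)
  ultimately have "card (strip_paths k (m + k)) \<le> card (strip_paths k m \<times> ?Q)"
    using finite_strip_paths card_step_lists(1) by (intro card_inj_on_le) auto
  also have "card ?Q = 2 ^ k - 1"
    using card_step_lists by (subst card_Diff_singleton) auto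
  then have "card (strip_paths k m \<times> ?Q) = card (strip_paths k m) * (2 ^ k - 1)"
    by (simp add: card_cartesian_product)
  finally show ?thesis .
qed

lemma card_strip_paths_le:
  assumes "k > 0"
  shows "real (card (strip_paths k m)) \<le> 2 ^ m * (1 - 1 / 2 ^ k) ^ (m div k)"
proof (induction m rule: less_induct)
  case (less m)
  show ?case
  proof (cases "m < k")
    case True
    have "card (strip_paths k m) \<le> card {p :: step list. length p = m}"
      by (rule card_mono[OF card_step_lists(1)]) (auto simp: strip_paths_def)
    then have "real (card (strip_paths k m)) \<le> real (2 ^ m)"
      unfolding card_step_lists(2) of_nat_le_iff .
    with True show ?thesis
      by simp
  next
    case False
    define l where "l = m - k"
    with False assms have l: "m = l + k" "l < m"
      by auto
    let ?c = "1 - 1 / 2 ^ k :: real"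
    have "real (card (strip_paths k m)) \<le> real (card (strip_paths k l) * (2 ^ k - 1))"
      unfolding l(1) of_nat_le_iff by (rule card_strip_paths_add)
    also have "\<dots> = real (card (strip_paths k l)) * (2 ^ k * ?c)"
      by (simp add: of_nat_diff right_diff_distrib)
    also have "\<dots> \<le> 2 ^ l * ?c ^ (l div k) * (2 ^ k * ?c)"
      by (intro mult_right_mono less.IH l(2)) auto
    also have "\<dots> = 2 ^ m * ?c ^ (m div k)"
      using assms by (simp add: l(1) power_add)
    finally show ?thesis .
  qed
qed

lemma not_reaching_subset_strip_paths:
  "{p \<in> dyck_paths n. \<not> reaches_line (int k) p} \<subseteq> strip_paths k (2 * n)"
  by (auto simp: dyck_paths_def reaches_line_def strip_paths_def not_le)

section \<open>The limit\<close>

text \<open>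
  The square is weaker than the denominator \<open>2 * n * (n + 1)\<close> that the proof gives. It is
  chosen because \<open>2 * n + 1 \<le> k * (2 * n div k + 1)\<close> then turns the whole bound for the
  fraction of confined paths into a function of the number \<open>2 * n div k\<close> of complete blocks.
\<close>

lemma catalan_lower_bound:
  assumes "n > 0"
  shows "4 ^ n / (2 * real n + 1)\<^sup>2 \<le> catalan n"
proof -
  have "4 ^ n / (2 * real n + 1)\<^sup>2 \<le> 4 ^ n / ((real n + 1) * (2 * real n))"
    using assms by (intro divide_left_mono mult_pos_pos zero_less_power)
      (auto simp: power2_eq_square algebra_simps)
  also have "\<dots> = 1 / (real n + 1) * (4 ^ n / (2 * real n))"
    by simp
  also have "\<dots> \<le> catalan n"
    unfolding catalan_def using central_binomial_lower_bound[OF assms]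
    by (intro mult_left_mono) auto
  finally show ?thesis .
qed

lemma quadratic_times_geometric_tendsto_0:
  fixes c :: real
  assumes "0 < c" "c < 1"
  shows "(\<lambda>j::nat. (real j + 1)\<^sup>2 * c ^ j) \<longlonglongrightarrow> 0"
  using assms by real_asymp

lemma not_reaching_fraction_le:
  assumes "k > 0" "n > 0"
  shows "real (card {p \<in> dyck_paths n. \<not> reaches_line (int k) p}) / catalan n
    \<le> (real k)\<^sup>2 * ((real (2 * n div k) + 1)\<^sup>2 * (1 - 1 / 2 ^ k) ^ (2 * n div k))"
proof -
  let ?j = "2 * n div k"
  let ?c = "1 - 1 / 2 ^ k :: real"
  have c: "0 \<le> ?c"
    by simp
  have pos: "0 < 4 ^ n / (2 * real n + 1)\<^sup>2"
    by simp
  have "card {p \<in> dyck_paths n. \<not> reaches_line (int k) p} \<le> card (strip_paths k (2 * n))"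
    by (rule card_mono[OF finite_strip_paths not_reaching_subset_strip_paths])
  then have "real (card {p \<in> dyck_paths n. \<not> reaches_line (int k) p}) \<le> 4 ^ n * ?c ^ ?j"
    using card_strip_paths_le[OF assms(1), of "2 * n"] by (simp add: power_mult)
  then have "real (card {p \<in> dyck_paths n. \<not> reaches_line (int k) p}) / catalan n
      \<le> 4 ^ n * ?c ^ ?j / (4 ^ n / (2 * real n + 1)\<^sup>2)"
    using catalan_lower_bound[OF assms(2)] pos by (intro frac_le) (auto simp: c)
  also have "\<dots> = (2 * real n + 1)\<^sup>2 * ?c ^ ?j"
    by simp
  also have "\<dots> \<le> (real k * (real ?j + 1))\<^sup>2 * ?c ^ ?j"
  proof -
    have "2 * n + 1 \<le> k * (?j + 1)"
      using assms(1) dividend_less_times_div[of k "2 * n"] by simp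
    then have "real (2 * n + 1) \<le> real (k * (?j + 1))"
      by (simp only: of_nat_le_iff)
    then have "2 * real n + 1 \<le> real k * (real ?j + 1)"
      by (simp add: algebra_simps)
    then show ?thesis
      by (intro mult_right_mono power_mono) (auto simp: c)
  qed
  finally show ?thesis
    by (simp add: power_mult_distrib mult.assoc)
qed

lemma not_reaching_fraction_tendsto_0:
  assumes "k > 0"
  shows "(\<lambda>n. real (card {p \<in> dyck_paths n. \<not> reaches_line (int k) p}) / catalan n)
    \<longlonglongrightarrow> 0"
proof (rule tendsto_sandwich)
  show "\<forall>\<^sub>F n in sequentially. 0 \<le> real (card {p \<in> dyck_paths n. \<not> reaches_line (int k) p}) / catalan n"
    by (simp add: catalan_def)
  show "\<forall>\<^sub>F n in sequentially. real (card {p \<in> dyck_paths n. \<not> reaches_line (int k) p}) / catalan n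
    \<le> (real k)\<^sup>2 * ((real (2 * n div k) + 1)\<^sup>2 * (1 - 1 / 2 ^ k) ^ (2 * n div k))"
    using eventually_gt_at_top[of 0]
    by eventually_elim (rule not_reaching_fraction_le[OF assms])
  have lim: "filterlim (\<lambda>n. 2 * n div k) at_top sequentially"
    unfolding filterlim_at_top_ge[where c = 0]
  proof (intro allI impI)
    fix Z :: nat
    show "\<forall>\<^sub>F n in sequentially. Z \<le> 2 * n div k"
      using eventually_ge_at_top[of "Z * k"]
      by eventually_elim (use assms in \<open>simp add: less_eq_div_iff_mult_less_eq\<close>)
  qed
  have "(\<lambda>j. (real k)\<^sup>2 * ((real j + 1)\<^sup>2 * (1 - 1 / 2 ^ k) ^ j)) \<longlonglongrightarrow> (real k)\<^sup>2 * 0"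
    using assms by (intro tendsto_mult_left quadratic_times_geometric_tendsto_0) auto
  from filterlim_compose[OF this lim] show "(\<lambda>n. (real k)\<^sup>2 * ((real (2 * n div k) + 1)\<^sup>2 * (1 - 1 / 2 ^ k) ^ (2 * n div k)))
    \<longlonglongrightarrow> 0"
    by simp
qed simp

theorem theorem4p1:
  fixes k :: int
  assumes "k \<ge> 1"
  shows "(\<forall>n\<ge>1. P n k = real (B n k) / catalan n) \<and>
    (\<lambda>n. P n k) \<longlonglongrightarrow> 1 \<and>
    (\<lambda>n. real (B n k) / catalan n) \<longlonglongrightarrow> 1"
proof -
  define m where "m = nat k"
  then have m: "k = int m" "m > 0"
    using assms by auto
  have P: "P n k = real (B n k) / catalan n" for n
  proof -
    have "dyck_paths n \<inter> {p. reaches_line k p} = {p \<in> dyck_paths n. reaches_line k p}"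
      by blast
    then show ?thesis
      by (simp add: P_def B_def measure_pmf_of_set dyck_paths_nonempty finite_dyck_paths
          card_dyck_paths)
  qed
  let ?N = "\<lambda>n. {p \<in> dyck_paths n. \<not> reaches_line (int m) p}"
  have split: "real (B n k) / catalan n = 1 - real (card (?N n)) / catalan n" for n
  proof -
    have "card (dyck_paths n) = B n k + card (?N n)"
      unfolding B_def m(1) by (subst card_Un_disjoint[symmetric])
        (auto simp: finite_dyck_paths intro: arg_cong[where f = card])
    then have "real (B n k) = catalan n - real (card (?N n))"
      unfolding card_dyck_paths[symmetric] by linarith
    moreover have "catalan n \<noteq> 0"
      by (simp add: catalan_def)
    ultimately show ?thesis
      by (simp add: diff_divide_distrib)
  qed
  have "(\<lambda>n. 1 - real (card (?N n)) / catalan n) \<longlonglongrightarrow> 1 - 0"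
    by (rule tendsto_diff[OF tendsto_const not_reaching_fraction_tendsto_0[OF m(2)]])
  then have "(\<lambda>n. real (B n k) / catalan n) \<longlonglongrightarrow> 1"
    unfolding split diff_0_right .
  then show ?thesis
    unfolding P by blast
qed

end
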